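(* Let $\mu>1$ and let $n\ge 2$ be an integer. For every integer $r$ with $0\le r\le n-1$, the derivatives of $\varphi^{(n,m)}$ are given by $$D^r\varphi^{(n,0)}=\nabla^r_{2^{-1}}\,\varphi^{(n-r,0)},\qquad D^r\varphi^{(n,m)}=\nabla^r_{2^{-m}}\,\varphi^{(n-r,m)}\quad (m>0).$$
   Context: $D$ is differentiation. For $h>0$ the backward finite difference operator is defined by $\nabla_h f=\frac1h\bigl(f-f(\cdot-h)\bigr)$, $\nabla_h^0 f=f$, $\nabla_h^r f=\nabla_h(\nabla_h^{r-1}f)$ for $r\ge1$. The Fourier transform is $\widehat f(\omega)=\int_{\mathbb{R}} f(x)e^{-i\omega x}\,dx$. Masks: fix a real parameter $\mu>1$. For an integer $n\ge 1$, let $a^{(n,0)}_0=a^{(n,0)}_1=\tfrac12$ and $a^{(n,0)}_\alpha=0$ otherwise; for $m\ge 1$ let $$a^{(n,m)}_\alpha=\frac{1}{2^{n+1+m^{-\mu}}}\left[\binom{n+1}{\alpha}+4\bigl(2^{m^{-\mu}}-1\bigr)\binom{n-1}{\alpha-1}\right],\quad 0\le\alpha\le n+1,$$ and $a^{(n,m)}_\alpha=0$ otherwise (with $\binom{p}{q}=0$ if $q<0$ or $q>p$). The symbols are $A^{(n,m)}(z)=\sum_\alpha a^{(n,m)}_\alpha z^\alpha$. Refinable functions: for integers $n\ge1$, $m\ge0$, $\varphi^{(n,m)}\in L_2(\mathbb{R})$ is the compactly supported function with $\widehat{\varphi}^{(n,m)}(\omega)=\prod_{k=m}^{\infty}A^{(n,k)}\bigl(e^{-i\omega/2^{k+1}}\bigr)$.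 For $n\ge2$ it belongs to $C^{n-1}(\mathbb{R})$. Equalities are between elements of $L_2(\mathbb{R})$ (almost everywhere). *)

theory Defs
  imports "HOL-Analysis.Analysis"
begin

text \<open>Elements of $L_2(\mathbb{R})$ are represented by Borel measurable functions
  \<open>real \<Rightarrow> complex\<close>; equality in $L_2(\mathbb{R})$ is equality almost everywhere.\<close>

definition L2 :: "(real \<Rightarrow> complex) set" where
  "L2 = {f \<in> borel_measurable lborel. integrable lborel (\<lambda>x. (norm (f x))\<^sup>2)}"

definition compactly_supported :: "(real \<Rightarrow> complex) \<Rightarrow> bool" where
  "compactly_supported f \<longleftrightarrow> (\<exists>K. compact K \<and> (AE x in lborel. x \<notin> K \<longrightarrow> f x = 0))"

definition fourier :: "(real \<Rightarrow> complex) \<Rightarrow> real \<Rightarrow> complex" where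
  "fourier f \<omega> = (LINT x|lborel. f x * exp (- (\<i> * complex_of_real (\<omega> * x))))"

definition nabla :: "real \<Rightarrow> (real \<Rightarrow> complex) \<Rightarrow> real \<Rightarrow> complex" where
  "nabla h f = (\<lambda>x. (f x - f (x - h)) / complex_of_real h)"

definition D :: "(real \<Rightarrow> complex) \<Rightarrow> real \<Rightarrow> complex" where
  "D f = (\<lambda>x. vector_derivative f (at x))"

definition C_class :: "nat \<Rightarrow> (real \<Rightarrow> complex) set" where
  "C_class r = {f. (\<forall>j<r. \<forall>x. (D ^^ j) f differentiable (at x)) \<and> continuous_on UNIV ((D ^^ r) f)}"

text \<open>\<open>D\<^sup>r f = g\<close> as elements of $L_2(\mathbb{R})$: the class of \<open>f\<close> contains a (necessarily unique)
  \<open>C\<^sup>r\<close> function, and the classical \<open>r\<close>-th derivative of that function equals \<open>g\<close> almost everywhere.\<close>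

definition has_L2_deriv :: "nat \<Rightarrow> (real \<Rightarrow> complex) \<Rightarrow> (real \<Rightarrow> complex) \<Rightarrow> bool" where
  "has_L2_deriv r f g \<longleftrightarrow>
     (\<exists>F \<in> C_class r. (AE x in lborel. F x = f x) \<and> (AE x in lborel. (D ^^ r) F x = g x))"

text \<open>Masks vanish at negative indices, so the index \<open>\<alpha>\<close> is a natural number. The case \<open>\<alpha> = 0\<close> is
  separated because \<open>\<alpha> - 1\<close> is truncated on naturals, whereas the binomial
  coefficient with lower index \<open>-1\<close> is \<open>0\<close>.\<close>

definition mask :: "real \<Rightarrow> nat \<Rightarrow> nat \<Rightarrow> nat \<Rightarrow> real" where
  "mask \<mu> n m \<alpha> =
     (if m = 0 then (if \<alpha> \<le> 1 then 1 / 2 else 0)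
      else if \<alpha> \<le> n + 1 then
        1 / (2 powr (real n + 1 + real m powr (- \<mu>))) *
        (real ((n + 1) choose \<alpha>) +
         4 * (2 powr (real m powr (- \<mu>)) - 1) *
           (if \<alpha> = 0 then 0 else real ((n - 1) choose (\<alpha> - 1))))
      else 0)"

definition mask_symbol :: "real \<Rightarrow> nat \<Rightarrow> nat \<Rightarrow> complex \<Rightarrow> complex" where
  "mask_symbol \<mu> n m z = (\<Sum>\<alpha>\<le>n + 1. complex_of_real (mask \<mu> n m \<alpha>) * z ^ \<alpha>)"

text \<open>The product over \<open>k \<ge> m\<close> is indexed by \<open>j = k - m\<close>. Square integrability and compact support
  make \<open>f\<close> integrable, so the Fourier integral is absolutely convergent. These conditions determine
  \<open>f\<close> up to a null set.\<close>

definition is_refinable :: "real \<Rightarrow> nat \<Rightarrow> nat \<Rightarrow> (real \<Rightarrow> complex) \<Rightarrow> bool" where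
  "is_refinable \<mu> n m f \<longleftrightarrow>
     f \<in> L2 \<and> compactly_supported f \<and>
     (\<forall>\<omega>. (\<lambda>j. mask_symbol \<mu> n (m + j) (exp (- (\<i> * complex_of_real (\<omega> / 2 ^ (m + j + 1))))))
            has_prod fourier f \<omega>)"

end

theory Submission
  imports Defs "HOL-Probability.Levy"
begin

text \<open>Why the theorem holds.  For \<open>m \<ge> 1\<close> the symbols satisfy
  \<open>A\<^bsup>(n+1,m)\<^esup>(z) = (1 + z) / 2 \<cdot> A\<^bsup>(n,m)\<^esup>(z)\<close>, because the binomials in the mask sum to powers of
  \<open>1 + z\<close> (\<open>mask_symbol_Suc\<close>).  The product of the factors \<open>(1 + e\<^bsup>-i\<omega>/2^(k+1)\<^esup>) / 2\<close> over \<open>k \<ge> m\<close> is the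
  transform of the uniform density on an interval of length \<open>h = 2\<^sup>-\<^sup>m\<close>.  Hence raising the order by one
  amounts to replacing a function by its mean over the interval from \<open>x - h\<close> to \<open>x\<close>, and the derivative of
  that mean is the backward difference \<open>\<nabla>\<^sub>h\<close> of the function (\<open>refinable_transform_box_mean\<close>,
  \<open>has_vector_derivative_box_mean\<close>).  Since \<open>D\<close> commutes with \<open>\<nabla>\<^sub>h\<close>, the formula for \<open>D\<^sup>r\<close> follows by
  iteration (\<open>backward_difference_chain\<close>).  At level \<open>0\<close> every order has the symbol \<open>(1 + z) / 2\<close>, so
  the functions of level \<open>0\<close> are means of two translates of those of level \<open>1\<close>, which explains the
  step \<open>1/2\<close> for \<open>m = 0\<close>.

  The derivative of the highest order, \<open>r = n - 1\<close>, is classical and continuous only if the function of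
  order \<open>1\<close> is continuous, and this is the analytic core.  Take a hat function of height \<open>2\<^sup>N\<close> and unit
  integral and apply the refinement steps of levels \<open>N - 1, \<dots>, m\<close>.  For vanishing weight
  \<open>2 powr k\<^sup>-\<^sup>\<mu> - 1\<close> the mask of order \<open>1\<close> would reproduce the hat exactly; in general consecutive iterates
  differ by at most a constant multiple of the weight in the supremum norm (\<open>lattice_bounded_refine_hat_diff\<close>,
  \<open>lattice_bounded_cascade\<close>).  The weights are summable as \<open>\<mu> > 1\<close>, so the iterates converge uniformly
  to a continuous function with the required transform (\<open>refinable_order_1_exists\<close>).

  The functions constructed this way agree almost everywhere with the given ones, because an
  integrable function is determined by its Fourier transform (\<open>fourier_unique\<close>), which reduces to
  the uniqueness theorem for characteristic functions of probability distributions.\<close>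

section \<open>The Fourier transform of integrable functions\<close>

lemma norm_fourier_kernel: "norm (exp (- (\<i> * complex_of_real t))) = 1"
  using norm_exp_i_times[of "- t"] by simp

lemma fourier_integrand_integrable:
  assumes "integrable lborel f"
  shows "integrable lborel (\<lambda>x. f x * exp (- (\<i> * complex_of_real (\<omega> * x))))"
proof (rule Bochner_Integration.integrable_bound[OF assms])
  have [measurable]: "f \<in> borel_measurable lborel"
    using assms by (rule borel_measurable_integrable)
  have [measurable]: "(\<lambda>x. exp (- (\<i> * complex_of_real (\<omega> * x)))) \<in> borel_measurable borel"
    by (intro borel_measurable_continuous_onI continuous_intros)
  show "(\<lambda>x. f x * exp (- (\<i> * complex_of_real (\<omega> * x)))) \<in> borel_measurable lborel"
    by measurable
qed (simp only: norm_mult norm_fourier_kernel, simp)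

lemma fourier_add:
  assumes "integrable lborel f" "integrable lborel g"
  shows "fourier (\<lambda>x. f x + g x) \<omega> = fourier f \<omega> + fourier g \<omega>"
  unfolding fourier_def distrib_right
  by (intro Bochner_Integration.integral_add fourier_integrand_integrable assms)

lemma fourier_cmult: "fourier (\<lambda>x. c * f x) \<omega> = c * fourier f \<omega>"
  unfolding fourier_def by (simp add: mult.assoc)

lemma fourier_diff:
  assumes "integrable lborel f" "integrable lborel g"
  shows "fourier (\<lambda>x. f x - g x) \<omega> = fourier f \<omega> - fourier g \<omega>"
  using fourier_add[OF assms(1) integrable_minus[OF assms(2)], of \<omega>] fourier_cmult[of "-1" g \<omega>]
  by simp

lemma fourier_sum:
  assumes "\<And>i. i \<in> I \<Longrightarrow> integrable lborel (f i)"
  shows "fourier (\<lambda>x. \<Sum>i\<in>I. f i x) \<omega> = (\<Sum>i\<in>I. fourier (f i) \<omega>)"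
  unfolding fourier_def sum_distrib_right
  by (intro Bochner_Integration.integral_sum fourier_integrand_integrable assms)

lemma fourier_shift:
  "fourier (\<lambda>x. f (x - t)) \<omega> = exp (- (\<i> * complex_of_real (\<omega> * t))) * fourier f \<omega>"
proof -
  have "fourier (\<lambda>x. f (x - t)) \<omega> =
      (LINT x|lborel. f x * exp (- (\<i> * complex_of_real (\<omega> * (t + x)))))"
    unfolding fourier_def by (subst lborel_integral_real_affine[where t = t and c = 1]) auto
  also have "\<dots> = (LINT x|lborel. exp (- (\<i> * complex_of_real (\<omega> * t))) *
      (f x * exp (- (\<i> * complex_of_real (\<omega> * x)))))"
    by (simp add: exp_add[symmetric] algebra_simps)
  finally show ?thesis
    unfolding fourier_def by simp
qed

lemma fourier_dilate:
  assumes "c > 0"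
  shows "fourier (\<lambda>x. complex_of_real c * f (c * x)) \<omega> = fourier f (\<omega> / c)"
  unfolding fourier_def
  using assms
  by (subst (2) lborel_integral_real_affine[where t = 0 and c = c])
    (auto simp: scaleR_conv_of_real mult.assoc)

lemma integrable_shift:
  fixes f :: "real \<Rightarrow> complex"
  assumes "integrable lborel f"
  shows "integrable lborel (\<lambda>x. f (x - t))"
  using lborel_integrable_real_affine[OF assms, of 1 "- t"] by (simp add: add.commute)

lemma fourier_tendsto_0:
  assumes f: "integrable lborel f" and s: "s \<longlonglongrightarrow> 0"
  shows "(\<lambda>i. fourier f (s i)) \<longlonglongrightarrow> (LINT x|lborel. f x)"
proof -
  have [measurable]: "f \<in> borel_measurable lborel"
    using f by (rule borel_measurable_integrable)
  have "(\<lambda>i. fourier f (s i)) \<longlonglongrightarrow> fourier f 0"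
    unfolding fourier_def
  proof (rule integral_dominated_convergence)
    show "integrable lborel (\<lambda>x. norm (f x))"
      using f by simp
    show "AE x in lborel. (\<lambda>i. f x * exp (- (\<i> * complex_of_real (s i * x))))
        \<longlonglongrightarrow> f x * exp (- (\<i> * complex_of_real (0 * x)))"
      by (intro AE_I2 tendsto_intros s)
    show "AE x in lborel. norm (f x * exp (- (\<i> * complex_of_real (s i * x)))) \<le> norm (f x)" for i
      by (simp only: norm_mult norm_fourier_kernel) simp
  qed (use fourier_integrand_integrable[OF f] in \<open>auto intro: borel_measurable_integrable\<close>)
  then show ?thesis
    by (simp add: fourier_def)
qed

text \<open>A nonnegative integrable function is, up to its mass, the density of a probability
  distribution, and its Fourier transform is the characteristic function of that distribution.\<close>

lemma fourier_unique_nonneg: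
  fixes p q :: "real \<Rightarrow> real"
  assumes p: "integrable lborel p" "\<And>x. p x \<ge> 0"
    and q: "integrable lborel q" "\<And>x. q x \<ge> 0"
    and eq: "\<And>\<omega>. fourier (\<lambda>x. of_real (p x)) \<omega> = fourier (\<lambda>x. of_real (q x)) \<omega>"
  shows "AE x in lborel. p x = q x"
proof -
  have [measurable]: "p \<in> borel_measurable lborel" "q \<in> borel_measurable lborel"
    using p q by (auto intro: borel_measurable_integrable)
  define c where "c = (LINT x|lborel. p x)"
  have "complex_of_real (LINT x|lborel. p x) = complex_of_real (LINT x|lborel. q x)"
    using eq[of 0] by (simp add: fourier_def)
  then have cq: "c = (LINT x|lborel. q x)"
    by (simp add: c_def)
  have "c \<ge> 0"
    unfolding c_def using p by (intro integral_nonneg_AE) auto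
  show ?thesis
  proof (cases "c = 0")
    case True
    then have "AE x in lborel. p x = 0" "AE x in lborel. q x = 0"
      using cq integral_nonneg_eq_0_iff_AE[OF p(1)] integral_nonneg_eq_0_iff_AE[OF q(1)] p(2) q(2)
      by (simp_all add: c_def)
    then show ?thesis by eventually_elim simp
  next
    case False
    with \<open>c \<ge> 0\<close> have "c > 0" by simp
    define dist where "dist u = density lborel (\<lambda>x. ennreal (u x / c))" for u :: "real \<Rightarrow> real"
    have dist: "real_distribution (dist u) \<and>
        (\<forall>t. char (dist u) t = fourier (\<lambda>x. of_real (u x)) (- t) / complex_of_real c)"
      if u: "integrable lborel u" "\<And>x. u x \<ge> 0" and cu: "c = (LINT x|lborel. u x)"
      for u :: "real \<Rightarrow> real"
    proof -
      have [measurable]: "u \<in> borel_measurable lborel"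
        using u by (auto intro: borel_measurable_integrable)
      have "emeasure (dist u) (space (dist u)) = (\<integral>\<^sup>+ x. ennreal (u x / c) \<partial>lborel)"
        by (simp add: dist_def emeasure_density)
      also have "\<dots> = ennreal (LINT x|lborel. u x / c)"
        using u \<open>c > 0\<close> by (intro nn_integral_eq_integral) auto
      also have "\<dots> = 1"
        using \<open>c > 0\<close> cu by simp
      finally have "real_distribution (dist u)"
        by (auto simp: real_distribution_def real_distribution_axioms_def dist_def
            intro!: prob_spaceI)
      moreover have "char (dist u) t = fourier (\<lambda>x. of_real (u x)) (- t) / complex_of_real c" for t
      proof -
        have "char (dist u) t = (LINT x|lborel. (u x / c) *\<^sub>R iexp (t * x))"
          unfolding char_def dist_def using u \<open>c > 0\<close> by (intro integral_density) auto
        also have "\<dots> = (LINT x|lborel. complex_of_real (u x) * iexp (t * x) / complex_of_real c)"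
          by (simp add: scaleR_conv_of_real)
        finally show ?thesis
          by (simp add: fourier_def)
      qed
      ultimately show ?thesis by blast
    qed
    have "char (dist p) = char (dist q)"
      using dist[OF p c_def] dist[OF q cq] eq by (intro ext) simp
    then have "dist p = dist q"
      using dist[OF p c_def] dist[OF q cq] by (intro Levy_uniqueness) auto
    then have "AE x in lborel. ennreal (p x / c) = ennreal (q x / c)"
      unfolding dist_def
      by (subst (asm) sigma_finite_measure.density_unique_iff[OF sigma_finite_lborel]) auto
    then show ?thesis
      using p q \<open>c > 0\<close> by (auto elim!: eventually_mono)
  qed
qed

text \<open>The positive and the negative part of \<open>f\<close> have the same transform.\<close>

lemma fourier_zero_imp_AE_zero_real:
  fixes f :: "real \<Rightarrow> real"
  assumes f: "integrable lborel f" and eq: "\<And>\<omega>. fourier (\<lambda>x. of_real (f x)) \<omega> = 0"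
  shows "AE x in lborel. f x = 0"
proof -
  have int: "integrable lborel (\<lambda>x. max 0 (f x))" "integrable lborel (\<lambda>x. max 0 (- f x))"
    using f by auto
  have "fourier (\<lambda>x. of_real (max 0 (f x))) \<omega> - fourier (\<lambda>x. of_real (max 0 (- f x))) \<omega> =
      fourier (\<lambda>x. of_real (f x)) \<omega>" for \<omega>
    using int by (subst fourier_diff[symmetric]) (auto intro!: arg_cong2[where f = fourier] simp: max_def)
  then have "AE x in lborel. max 0 (f x) = max 0 (- f x)"
    using int eq by (intro fourier_unique_nonneg) auto
  then show ?thesis
    by eventually_elim (auto simp: max_def split: if_splits)
qed

lemma fourier_cnj: "fourier (\<lambda>x. cnj (f x)) \<omega> = cnj (fourier f (- \<omega>))"
  unfolding fourier_def by (subst Bochner_Integration.integral_cnj[symmetric]) (simp add: exp_cnj)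

text \<open>The real and imaginary parts of a function with vanishing transform also have vanishing
  transforms, since conjugating a function conjugates and reflects its transform.\<close>

lemma fourier_unique:
  assumes f: "integrable lborel f" and g: "integrable lborel g"
    and eq: "\<And>\<omega>. fourier f \<omega> = fourier g \<omega>"
  shows "AE x in lborel. f x = g x"
proof -
  define d where "d = (\<lambda>x. f x - g x)"
  have d: "integrable lborel d" and d': "integrable lborel (\<lambda>x. cnj (d x))"
    using f g by (auto simp: d_def)
  have "fourier d \<omega> = 0" for \<omega>
    using f g eq by (simp add: d_def fourier_diff)
  moreover from this have "fourier (\<lambda>x. cnj (d x)) \<omega> = 0" for \<omega>
    by (simp add: fourier_cnj)
  ultimately have re: "fourier (\<lambda>x. (1/2) * (d x + cnj (d x))) \<omega> = 0"
    and im: "fourier (\<lambda>x. (-\<i>/2) * (d x - cnj (d x))) \<omega> = 0" for \<omega>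
    by (simp_all only: fourier_cmult fourier_add[OF d d'] fourier_diff[OF d d'])
      simp_all
  have re_eq: "(1/2) * (z + cnj z) = complex_of_real (Re z)"
    and im_eq: "(-\<i>/2) * (z - cnj z) = complex_of_real (Im z)" for z
    by (simp_all add: complex_eq_iff)
  have "AE x in lborel. Re (d x) = 0" "AE x in lborel. Im (d x) = 0"
    using d re im unfolding re_eq im_eq by (auto intro!: fourier_zero_imp_AE_zero_real)
  then show ?thesis
    by eventually_elim (auto simp: d_def complex_eq_iff)
qed

text \<open>Square integrability gives integrability on the compact support, because
  \<open>\<bar>f\<bar> \<le> 1 + \<bar>f\<bar>\<^sup>2\<close>.\<close>

lemma L2_compactly_supported_integrable:
  assumes "f \<in> L2" "compactly_supported f"
  shows "integrable lborel f"
proof -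
  obtain K where K: "compact K" "AE x in lborel. x \<notin> K \<longrightarrow> f x = 0"
    using assms by (auto simp: compactly_supported_def)
  have f: "f \<in> borel_measurable lborel" "integrable lborel (\<lambda>x. (norm (f x))\<^sup>2)"
    using assms by (auto simp: L2_def)
  have "integrable lborel (\<lambda>x. indicator K x + (norm (f x))\<^sup>2)"
    using K f by (intro Bochner_Integration.integrable_add integrable_real_indicator
        emeasure_compact_finite) (auto simp: borel_compact)
  then show ?thesis
  proof (rule Bochner_Integration.integrable_bound)
    have "norm z \<le> 1 + (norm z)\<^sup>2" for z :: complex
      using zero_le_power2[of "norm z - 1/2"] by (simp add: power2_eq_square algebra_simps)
    then show "AE x in lborel. norm (f x) \<le> norm (indicator K x + (norm (f x))\<^sup>2)"
      using K(2) by (auto elim!: eventually_mono simp: indicator_def abs_of_nonneg)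
  qed (use f in simp)
qed

section \<open>Continuous functions of compact support\<close>

definition Cc :: "(real \<Rightarrow> complex) set" where
  "Cc = {f. continuous_on UNIV f \<and> (\<exists>K. \<forall>x. \<bar>x\<bar> > K \<longrightarrow> f x = 0)}"

lemma CcI: "continuous_on UNIV f \<Longrightarrow> (\<And>x. \<bar>x\<bar> > K \<Longrightarrow> f x = 0) \<Longrightarrow> f \<in> Cc"
  by (auto simp: Cc_def)

lemma CcE:
  assumes "f \<in> Cc"
  obtains K where "continuous_on UNIV f" "K \<ge> 0" "\<And>x. \<bar>x\<bar> > K \<Longrightarrow> f x = 0"
proof -
  obtain K where "continuous_on UNIV f" "\<And>x. \<bar>x\<bar> > K \<Longrightarrow> f x = 0"
    using assms by (auto simp: Cc_def)
  then show ?thesis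
    by (intro that[of "max 0 K"]) auto
qed

lemma Cc_continuous: "f \<in> Cc \<Longrightarrow> continuous_on UNIV f"
  by (simp add: Cc_def)

lemma Cc_mult_continuous:
  assumes "f \<in> Cc" "continuous_on UNIV g"
  shows "(\<lambda>x. g x * f x) \<in> Cc" "(\<lambda>x. f x * g x) \<in> Cc"
  using assms by (auto simp: Cc_def intro!: continuous_intros)

lemma Cc_cmult: "f \<in> Cc \<Longrightarrow> (\<lambda>x. c * f x) \<in> Cc"
  by (rule Cc_mult_continuous) auto

lemma Cc_add:
  assumes "f \<in> Cc" "g \<in> Cc"
  shows "(\<lambda>x. f x + g x) \<in> Cc"
proof -
  obtain K L where "\<And>x. \<bar>x\<bar> > K \<Longrightarrow> f x = 0" "\<And>x. \<bar>x\<bar> > L \<Longrightarrow> g x = 0"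
    using assms by (metis CcE)
  then show ?thesis
    using assms[THEN Cc_continuous] by (intro CcI[where K = "max K L"] continuous_intros) auto
qed

lemma Cc_sum: "finite I \<Longrightarrow> (\<And>i. i \<in> I \<Longrightarrow> f i \<in> Cc) \<Longrightarrow> (\<lambda>x. \<Sum>i\<in>I. f i x) \<in> Cc"
proof (induction I rule: finite_induct)
  case empty
  show ?case by (simp add: Cc_def)
next
  case (insert i I)
  then show ?case by (simp add: Cc_add)
qed

lemma Cc_shift:
  assumes "f \<in> Cc"
  shows "(\<lambda>x. f (x - t)) \<in> Cc"
proof -
  obtain K where "\<And>x. \<bar>x\<bar> > K \<Longrightarrow> f x = 0"
    using assms by (metis CcE)
  moreover have "continuous_on UNIV (\<lambda>x. f (x - t))"
    using Cc_continuous[OF assms]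
    by (rule continuous_on_compose2) (auto intro!: continuous_intros)
  ultimately show ?thesis
    by (intro CcI[where K = "K + \<bar>t\<bar>"]) auto
qed

lemma Cc_integrable:
  assumes "f \<in> Cc"
  shows "integrable lborel f"
proof -
  obtain K where K: "continuous_on UNIV f" "\<And>x. \<bar>x\<bar> > K \<Longrightarrow> f x = 0"
    using assms by (metis CcE)
  have "integrable lborel (\<lambda>x. indicator {-K..K} x *\<^sub>R f x)"
    using K(1) by (intro borel_integrable_compact) (auto intro: continuous_on_subset)
  also have "(\<lambda>x. indicator {-K..K} x *\<^sub>R f x) = f"
    using K(2) by (force simp: indicator_def)
  finally show ?thesis .
qed

lemma integral_derivative_Cc:
  assumes G: "G \<in> Cc" and g: "g \<in> Cc"
    and deriv: "\<And>x. (G has_vector_derivative g x) (at x)"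
  shows "(LINT x|lborel. g x) = 0"
proof -
  obtain K L where "\<And>x. \<bar>x\<bar> > K \<Longrightarrow> G x = 0" and L: "L \<ge> 0" "\<And>x. \<bar>x\<bar> > L \<Longrightarrow> g x = 0"
    using G g by (metis CcE)
  define M where "M = max K L + 1"
  have M: "M \<ge> 0" "G M = 0" "G (- M) = 0" "\<And>x. \<bar>x\<bar> > M \<Longrightarrow> g x = 0"
    using L \<open>\<And>x. \<bar>x\<bar> > K \<Longrightarrow> G x = 0\<close> by (auto simp: M_def)
  have "has_bochner_integral lborel (\<lambda>x. indicator {-M..M} x *\<^sub>R g x) (G M - G (- M))"
    using M(1) Cc_continuous[OF g]
    by (intro has_bochner_integral_FTC_Icc)
      (auto intro: has_vector_derivative_at_within deriv continuous_on_subset)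
  moreover have "(\<lambda>x. indicator {-M..M} x *\<^sub>R g x) = g"
    using M(4) by (force simp: indicator_def)
  ultimately show ?thesis
    using M by (simp add: has_bochner_integral_iff)
qed

section \<open>Backward differences and derivatives\<close>

lemma nabla_Cc:
  assumes "f \<in> Cc"
  shows "nabla h f \<in> Cc"
proof -
  have "nabla h f = (\<lambda>x. (1 / of_real h) * (f x + (-1) * f (x - h)))"
    by (simp add: nabla_def fun_eq_iff)
  then show ?thesis
    using assms by (simp only:) (intro Cc_cmult Cc_add Cc_shift)
qed

lemma nabla_pow_Cc: "f \<in> Cc \<Longrightarrow> (nabla h ^^ j) f \<in> Cc"
  by (induction j) (auto intro: nabla_Cc)

lemma has_vector_derivative_shift:
  fixes f :: "real \<Rightarrow> complex"
  assumes "(f has_vector_derivative f') (at (x - h))"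
  shows "((\<lambda>x. f (x - h)) has_vector_derivative f') (at x)"
proof -
  have "((\<lambda>x. x - h) has_vector_derivative 1) (at x)"
    using has_vector_derivative_diff[OF has_vector_derivative_id has_vector_derivative_const]
    by fastforce
  from vector_diff_chain_at[OF this assms] show ?thesis
    by (simp add: o_def)
qed

lemma has_vector_derivative_nabla:
  assumes "\<And>x. (f has_vector_derivative f' x) (at x)"
  shows "(nabla h f has_vector_derivative nabla h f' x) (at x)"
  unfolding nabla_def
  by (intro has_vector_derivative_divide has_vector_derivative_diff assms
      has_vector_derivative_shift)

lemma has_vector_derivative_nabla_pow:
  assumes "\<And>x. (f has_vector_derivative f' x) (at x)"
  shows "((nabla h ^^ j) f has_vector_derivative (nabla h ^^ j) f' x) (at x)"
proof (induction j arbitrary: x)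
  case (Suc j)
  then show ?case
    by (auto intro: has_vector_derivative_nabla)
qed (use assms in simp)

text \<open>Differentiation commutes with differences, so a relation \<open>D (\<gamma> (i + 1)) = \<nabla> (\<gamma> i)\<close> along a
  sequence of functions can be iterated; continuity of the lowest function
  involved gives the full order of smoothness.\<close>

lemma backward_difference_chain:
  assumes cont: "\<And>i. \<gamma> i \<in> Cc"
    and deriv: "\<And>i x. (\<gamma> (Suc i) has_vector_derivative nabla h (\<gamma> i) x) (at x)"
  shows "(D ^^ r) (\<gamma> (i + r)) = (nabla h ^^ r) (\<gamma> i)" and "\<gamma> (i + r) \<in> C_class r"
proof -
  have step: "((nabla h ^^ j) (\<gamma> (Suc i)) has_vector_derivative (nabla h ^^ Suc j) (\<gamma> i) x) (at x)"
    for i j x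
    unfolding funpow_Suc_right o_def by (intro has_vector_derivative_nabla_pow deriv)
  have iter: "(D ^^ j) (\<gamma> (i + j)) = (nabla h ^^ j) (\<gamma> i)" for i j
  proof (induction j arbitrary: i)
    case (Suc j)
    have "(D ^^ Suc j) (\<gamma> (i + Suc j)) = D ((D ^^ j) (\<gamma> (Suc i + j)))"
      by simp
    also have "\<dots> = D ((nabla h ^^ j) (\<gamma> (Suc i)))"
      by (simp only: Suc.IH)
    also have "\<dots> = (nabla h ^^ Suc j) (\<gamma> i)"
      unfolding D_def by (intro ext vector_derivative_at step)
    finally show ?case .
  qed simp
  show "(D ^^ r) (\<gamma> (i + r)) = (nabla h ^^ r) (\<gamma> i)"
    by (rule iter)
  show "\<gamma> (i + r) \<in> C_class r"
    unfolding C_class_def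
  proof (intro CollectI conjI allI impI)
    fix j x
    assume "j < r"
    define d where "d = r - Suc j"
    with \<open>j < r\<close> have d: "r = Suc (d + j)"
      by simp
    have "(D ^^ j) (\<gamma> (i + r)) = (nabla h ^^ j) (\<gamma> (Suc (i + d)))"
      using iter[of j "Suc (i + d)"] by (simp add: d add.assoc)
    then show "(D ^^ j) (\<gamma> (i + r)) differentiable at x"
      using step[of j "i + d" x] by (auto intro: differentiableI_vector)
  qed (simp add: iter Cc_continuous nabla_pow_Cc cont)
qed

section \<open>Averaging over an interval\<close>

definition primitive :: "(real \<Rightarrow> complex) \<Rightarrow> real \<Rightarrow> complex" where
  "primitive g u = (LBINT y=0..u. g y)"

lemma has_vector_derivative_primitive:
  assumes "continuous_on UNIV g"
  shows "(primitive g has_vector_derivative g x) (at x)"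
proof -
  define a b where "a = min 0 x - 1" and "b = max 0 x + 1"
  have "((\<lambda>u. LBINT y=(0::real)..u. g y) has_vector_derivative g x) (at x within {a..b})"
    by (intro interval_integral_FTC2 continuous_on_subset[OF assms]) (auto simp: a_def b_def)
  moreover have "at x within {a..b} = at x"
    by (rule at_within_Icc_at) (auto simp: a_def b_def)
  ultimately show ?thesis
    unfolding primitive_def[abs_def] by (simp add: zero_ereal_def)
qed

text \<open>The mean value of \<open>g\<close> over the interval from \<open>x - h\<close> to \<open>x\<close>.\<close>

definition box_mean :: "real \<Rightarrow> (real \<Rightarrow> complex) \<Rightarrow> real \<Rightarrow> complex" where
  "box_mean h g = nabla h (primitive g)"

lemma has_vector_derivative_box_mean:
  assumes "g \<in> Cc"
  shows "(box_mean h g has_vector_derivative nabla h g x) (at x)"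
  unfolding box_mean_def
  by (intro has_vector_derivative_nabla has_vector_derivative_primitive Cc_continuous assms)

lemma box_mean_Cc:
  assumes "g \<in> Cc" "h > 0"
  shows "box_mean h g \<in> Cc"
proof -
  obtain K where K: "\<And>x. \<bar>x\<bar> > K \<Longrightarrow> g x = 0"
    using assms by (metis CcE)
  show ?thesis
  proof (rule CcI[where K = "K + h"])
    show "continuous_on UNIV (box_mean h g)"
      using has_vector_derivative_continuous[OF has_vector_derivative_box_mean[OF assms(1)]]
      by (simp add: continuous_at_imp_continuous_on)
    fix x :: real
    assume x: "\<bar>x\<bar> > K + h"
    have "(g has_integral (primitive g x - primitive g (x - h))) {x - h..x}"
      using assms(2) has_vector_derivative_primitive[OF Cc_continuous[OF assms(1)]]
      by (intro fundamental_theorem_of_calculus) (auto intro: has_vector_derivative_at_within)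
    moreover have "(g has_integral 0) {x - h..x}"
      using x assms(2) by (intro has_integral_is_0 K) auto
    ultimately have "primitive g x - primitive g (x - h) = 0"
      by (rule has_integral_unique)
    then show "box_mean h g x = 0"
      by (simp add: box_mean_def nabla_def)
  qed
qed

lemma fourier_nabla:
  assumes "g \<in> Cc"
  shows "fourier (nabla h g) \<omega> =
    (1 - exp (- (\<i> * complex_of_real (\<omega> * h)))) / of_real h * fourier g \<omega>"
proof -
  have "nabla h g = (\<lambda>x. (1 / of_real h) * (g x - g (x - h)))"
    by (simp add: nabla_def fun_eq_iff)
  then show ?thesis
    using Cc_integrable[OF assms]
    by (simp only: fourier_cmult fourier_diff integrable_shift fourier_shift)
      (simp add: algebra_simps diff_divide_distrib)
qed

lemma fourier_derivative:
  assumes "G \<in> Cc" "g \<in> Cc" and deriv: "\<And>x. (G has_vector_derivative g x) (at x)"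
  shows "fourier g \<omega> = \<i> * of_real \<omega> * fourier G \<omega>"
proof -
  define e where "e x = exp (- (\<i> * complex_of_real (\<omega> * x)))" for x
  define c where "c = - (\<i> * complex_of_real \<omega>)"
  have e: "e = (\<lambda>x. exp (c * of_real x))"
    by (simp add: e_def c_def mult.assoc fun_eq_iff)
  have e_deriv: "(e has_vector_derivative c * e x) (at x)" for x
    unfolding e using exp_scaleR_has_vector_derivative_right[of c x UNIV]
    by (simp add: scaleR_conv_of_real mult.commute)
  have e_cont: "continuous_on UNIV e"
    unfolding e by (intro continuous_intros)
  have "(LINT x|lborel. G x * (c * e x) + g x * e x) = 0"
  proof (rule integral_derivative_Cc)
    show "((\<lambda>x. G x * e x) has_vector_derivative (G x * (c * e x) + g x * e x)) (at x)" for x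
      by (intro has_vector_derivative_mult deriv e_deriv)
  qed (intro Cc_add Cc_mult_continuous assms e_cont continuous_intros)+
  also have "(\<lambda>x. G x * (c * e x) + g x * e x) = (\<lambda>x. c * (G x * e x) + g x * e x)"
    by (simp add: mult_ac)
  also have "(LINT x|lborel. c * (G x * e x) + g x * e x) = c * fourier G \<omega> + fourier g \<omega>"
    using Cc_integrable[OF Cc_mult_continuous(2)[OF assms(1) e_cont]]
      Cc_integrable[OF Cc_mult_continuous(2)[OF assms(2) e_cont]]
    by (subst Bochner_Integration.integral_add) (auto simp: fourier_def e_def)
  finally show ?thesis
    by (simp add: c_def add_eq_0_iff)
qed

text \<open>Differentiation loses the mean, so the frequency \<open>0\<close> needs a separate argument: integrate
  \<open>x \<cdot> D G\<close> by parts instead of \<open>D G\<close>.\<close>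

lemma integral_box_mean:
  assumes g: "g \<in> Cc" and "h > 0"
  shows "(LINT x|lborel. box_mean h g x) = (LINT x|lborel. g x)"
proof -
  define G where "G = box_mean h g"
  have G: "G \<in> Cc"
    unfolding G_def by (intro box_mean_Cc assms)
  have id_deriv: "((\<lambda>x. complex_of_real x) has_vector_derivative 1) (at x)" for x
    using has_vector_derivative_of_real[OF DERIV_ident, of "at x"] by simp
  have xg: "(\<lambda>x. of_real x * g x) \<in> Cc"
    by (intro Cc_mult_continuous g continuous_intros)
  have xng: "(\<lambda>x. of_real x * nabla h g x) \<in> Cc"
    by (intro Cc_mult_continuous nabla_Cc g continuous_intros)
  have "(LINT x|lborel. of_real x * nabla h g x + 1 * G x) = 0"
  proof (rule integral_derivative_Cc)
    show "((\<lambda>x. of_real x * G x) has_vector_derivative (of_real x * nabla h g x + 1 * G x)) (at x)" for x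
      unfolding G_def
      by (intro has_vector_derivative_mult has_vector_derivative_box_mean g id_deriv)
  qed (intro Cc_add Cc_mult_continuous nabla_Cc g G continuous_intros)+
  then have 1: "(LINT x|lborel. of_real x * nabla h g x) + (LINT x|lborel. G x) = 0"
    using Cc_integrable[OF xng] Cc_integrable[OF G]
    by (subst Bochner_Integration.integral_add[symmetric]) auto
  have 2: "(LINT x|lborel. of_real x * nabla h g x) = - (LINT x|lborel. g x)"
  proof -
    define k where "k = (\<lambda>x. complex_of_real (x + h) * g x)"
    have k: "k \<in> Cc"
      unfolding k_def by (intro Cc_mult_continuous g continuous_intros)
    have "(\<lambda>x. of_real x * nabla h g x) = (\<lambda>x. (of_real x * g x - k (x - h)) / of_real h)"
      by (simp add: nabla_def k_def algebra_simps)
    then have "(LINT x|lborel. of_real x * nabla h g x) =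
        ((LINT x|lborel. of_real x * g x) - (LINT x|lborel. k (x - h))) / of_real h"
      using Cc_integrable[OF xg] Cc_integrable[OF Cc_shift[OF k]] by simp
    also have "(LINT x|lborel. k (x - h)) = (LINT x|lborel. k x)"
      by (subst lborel_integral_real_affine[where t = h and c = 1]) auto
    also have "\<dots> = (LINT x|lborel. of_real x * g x) + of_real h * (LINT x|lborel. g x)"
      unfolding k_def using Cc_integrable[OF xg] Cc_integrable[OF g]
      by (simp add: distrib_right)
    finally show ?thesis
      using \<open>h > 0\<close> by simp
  qed
  show ?thesis
    using 1 2 by (simp add: G_def)
qed

section \<open>The symbols and their partial products\<close>

abbreviation weight :: "real \<Rightarrow> nat \<Rightarrow> real" where
  "weight \<mu> k \<equiv> 2 powr (real k powr (- \<mu>)) - 1"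

lemma mask_symbol_closed_form:
  assumes "n \<ge> 1" "k \<ge> 1"
  shows "mask_symbol \<mu> n k z = of_real (1 / 2 powr (real n + 1 + real k powr (- \<mu>))) *
    ((1 + z) ^ (n + 1) + of_real (4 * weight \<mu> k) * z * (1 + z) ^ (n - 1))"
proof -
  define q where "q = 1 / 2 powr (real n + 1 + real k powr (- \<mu>))"
  define c where "c = 4 * weight \<mu> k"
  obtain n' where n: "n = Suc n'"
    using assms by (cases n) auto
  have "mask_symbol \<mu> n k z = (\<Sum>\<alpha>\<le>n + 1. of_real q * (of_nat ((n + 1) choose \<alpha>) * z ^ \<alpha> +
      of_real c * (of_nat (if \<alpha> = 0 then 0 else (n - 1) choose (\<alpha> - 1)) * z ^ \<alpha>)))"
    unfolding mask_symbol_def using assms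
    by (intro sum.cong refl) (auto simp: mask_def q_def c_def algebra_simps)
  also have "\<dots> = of_real q * ((\<Sum>\<alpha>\<le>n + 1. of_nat ((n + 1) choose \<alpha>) * z ^ \<alpha>) +
      of_real c * (\<Sum>\<alpha>\<le>n + 1. of_nat (if \<alpha> = 0 then 0 else (n - 1) choose (\<alpha> - 1)) * z ^ \<alpha>))"
    by (simp add: sum_distrib_left sum.distrib distrib_left)
  also have "(\<Sum>\<alpha>\<le>n + 1. of_nat ((n + 1) choose \<alpha>) * z ^ \<alpha>) = (1 + z) ^ (n + 1)"
    using binomial_ring[of z 1 "n + 1"] by (simp add: add.commute)
  also have "(\<Sum>\<alpha>\<le>n + 1. of_nat (if \<alpha> = 0 then 0 else (n - 1) choose (\<alpha> - 1)) * z ^ \<alpha>) =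
      (\<Sum>\<alpha>\<le>Suc n'. of_nat (n' choose \<alpha>) * z ^ Suc \<alpha>)"
    unfolding n add_Suc Suc_eq_plus1[symmetric] by (subst sum.atMost_Suc_shift) simp
  also have "\<dots> = z * (\<Sum>\<alpha>\<le>n'. of_nat (n' choose \<alpha>) * z ^ \<alpha>)"
    by (simp add: sum_distrib_left mult_ac)
  also have "(\<Sum>\<alpha>\<le>n'. of_nat (n' choose \<alpha>) * z ^ \<alpha>) = (1 + z) ^ (n - 1)"
    using binomial_ring[of z 1 n'] by (simp add: add.commute n)
  finally show ?thesis
    by (simp add: q_def c_def mult.assoc)
qed

lemma mask_symbol_Suc:
  assumes "n \<ge> 1" "k \<ge> 1"
  shows "mask_symbol \<mu> (Suc n) k z = (1 + z) / 2 * mask_symbol \<mu> n k z"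
proof -
  have "2 powr (real (Suc n) + 1 + real k powr (- \<mu>)) = 2 * 2 powr (real n + 1 + real k powr (- \<mu>))"
    by (simp add: powr_add)
  moreover have "(1 + z) ^ (Suc n + 1) + of_real (4 * weight \<mu> k) * z * (1 + z) ^ (Suc n - 1) =
      (1 + z) * ((1 + z) ^ (n + 1) + of_real (4 * weight \<mu> k) * z * (1 + z) ^ (n - 1))"
    using assms by (cases n) (auto simp: algebra_simps)
  ultimately show ?thesis
    using assms by (subst (1 2) mask_symbol_closed_form) (simp_all only:, simp_all)
qed

lemma mask_symbol_0: "mask_symbol \<mu> n 0 z = (1 + z) / 2"
proof -
  have "mask_symbol \<mu> n 0 z = (\<Sum>\<alpha>\<in>{0, 1}. complex_of_real (mask \<mu> n 0 \<alpha>) * z ^ \<alpha>)"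
    unfolding mask_symbol_def by (rule sum.mono_neutral_right) (auto simp: mask_def)
  then show ?thesis
    by (simp add: mask_def add_divide_distrib)
qed

definition symbol_prod :: "real \<Rightarrow> nat \<Rightarrow> nat \<Rightarrow> nat \<Rightarrow> real \<Rightarrow> complex" where
  "symbol_prod \<mu> n m N \<omega> =
     (\<Prod>j<N. mask_symbol \<mu> n (m + j) (exp (- (\<i> * complex_of_real (\<omega> / 2 ^ (m + j + 1))))))"

text \<open>The description of the refinable functions on the Fourier side.  Limits being unique, it
  determines the transform of \<open>g\<close>.\<close>

definition refinable_transform :: "real \<Rightarrow> nat \<Rightarrow> nat \<Rightarrow> (real \<Rightarrow> complex) \<Rightarrow> bool" where
  "refinable_transform \<mu> n m g \<longleftrightarrow> (\<forall>\<omega>. (\<lambda>N. symbol_prod \<mu> n m N \<omega>) \<longlonglongrightarrow> fourier g \<omega>)"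

lemma symbol_prod_shift:
  "symbol_prod \<mu> n m (Suc N) \<omega> =
    mask_symbol \<mu> n m (exp (- (\<i> * complex_of_real (\<omega> / 2 ^ (m + 1))))) *
      symbol_prod \<mu> n (Suc m) N \<omega>"
  unfolding symbol_prod_def by (subst prod.lessThan_Suc_shift) simp

lemma is_refinable_imp_AE_eq:
  assumes "is_refinable \<mu> n m f" "refinable_transform \<mu> n m g" "g \<in> Cc"
  shows "AE x in lborel. f x = g x"
proof (rule fourier_unique)
  show "integrable lborel f"
    using assms by (auto simp: is_refinable_def intro: L2_compactly_supported_integrable)
  show "integrable lborel g"
    using assms by (rule_tac Cc_integrable)
  show "fourier f \<omega> = fourier g \<omega>" for \<omega>
  proof (rule LIMSEQ_unique)
    show "(\<lambda>N. symbol_prod \<mu> n m N \<omega>) \<longlonglongrightarrow> fourier g \<omega>"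
      using assms by (simp add: refinable_transform_def)
    show "(\<lambda>N. symbol_prod \<mu> n m N \<omega>) \<longlonglongrightarrow> fourier f \<omega>"
      unfolding symbol_prod_def
      using assms by (intro has_prod_imp_tendsto') (simp add: is_refinable_def)
  qed
qed

section \<open>Raising the order by one\<close>

text \<open>The dyadic product formula for the transform of an interval, a form of
  \<open>sin t / t = \<Prod> cos (t / 2\<^sup>j)\<close>; the product telescopes by \<open>(1 - z) (1 + z) = 1 - z\<^sup>2\<close>.\<close>

lemma box_product_telescopes:
  fixes e :: "nat \<Rightarrow> complex"
  assumes e: "\<And>k. e k = e (Suc k) ^ 2"
  shows "(\<Prod>j<N. (1 + e (m + j + 1)) / 2) * (2 ^ (m + N) * (1 - e (m + N))) = 2 ^ m * (1 - e m)"
proof (induction N)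
  case (Suc N)
  have sq: "e (m + N) = e (Suc (m + N)) * e (Suc (m + N))"
    using e[of "m + N"] by (simp add: power2_eq_square)
  have "(1 + e (m + N + 1)) / 2 * (2 ^ (m + Suc N) * (1 - e (m + Suc N))) =
      2 ^ (m + N) * (1 - e (m + N))"
    unfolding sq by (simp add: field_simps)
  then show ?case
    using Suc by (simp only: prod.lessThan_Suc mult.assoc)
qed simp

lemma box_product_limit:
  assumes "\<omega> \<noteq> 0"
  shows "(\<lambda>N. \<Prod>j<N. (1 + exp (- (\<i> * complex_of_real (\<omega> / 2 ^ (m + j + 1))))) / 2)
    \<longlonglongrightarrow> 2 ^ m * (1 - exp (- (\<i> * complex_of_real (\<omega> / 2 ^ m)))) / (\<i> * of_real \<omega>)"
proof -
  define e where "e k = exp (- (\<i> * complex_of_real (\<omega> / 2 ^ k)))" for k :: nat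
  have e: "e k = e (Suc k) ^ 2" for k
    by (simp add: e_def exp_double[symmetric])
  define d where "d k = 2 ^ k * (1 - e k)" for k
  have "((\<lambda>z. (1 - exp (- (z * (\<i> * of_real \<omega>)))) / z) \<longlongrightarrow> \<i> * of_real \<omega>) (at (0::complex))"
  proof -
    have "((\<lambda>z. 1 - exp (- (z * (\<i> * of_real \<omega>)))) has_field_derivative \<i> * of_real \<omega>) (at (0::complex))"
      by (auto intro!: derivative_eq_intros)
    then show ?thesis
      by (simp add: has_field_derivative_iff)
  qed
  moreover have "filterlim (\<lambda>k. (1 / 2 :: complex) ^ k) (at 0) sequentially"
    by (intro filterlim_atI LIMSEQ_power_zero) auto
  ultimately have "(\<lambda>k. (1 - exp (- ((1/2) ^ k * (\<i> * of_real \<omega>)))) / (1/2) ^ k) \<longlonglongrightarrow> \<i> * of_real \<omega>"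
    by (rule filterlim_compose)
  also have "(\<lambda>k. (1 - exp (- ((1/2) ^ k * (\<i> * of_real \<omega>)))) / (1/2) ^ k) = d"
    by (simp add: fun_eq_iff d_def e_def power_divide mult_ac)
  finally have d: "d \<longlonglongrightarrow> \<i> * of_real \<omega>" .
  have "(\<lambda>N. d m / d (m + N)) \<longlonglongrightarrow> d m / (\<i> * of_real \<omega>)"
    using assms LIMSEQ_ignore_initial_segment[OF d, of m]
    by (intro tendsto_divide tendsto_const) (simp_all add: add.commute)
  moreover have "eventually (\<lambda>N. d m / d (m + N) = (\<Prod>j<N. (1 + e (m + j + 1)) / 2)) sequentially"
  proof -
    have "eventually (\<lambda>k. d k \<noteq> 0) sequentially"
      using d assms by (intro tendsto_imp_eventually_ne) auto
    then have "eventually (\<lambda>N. d (N + m) \<noteq> 0) sequentially"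
      by (rule sequentially_offset)
    then show ?thesis
    proof eventually_elim
      case (elim N)
      have "d m = (\<Prod>j<N. (1 + e (m + j + 1)) / 2) * d (m + N)"
        unfolding d_def using box_product_telescopes[of e m N, OF e] by (rule sym)
      with elim show ?case
        by (simp add: add.commute)
    qed
  qed
  ultimately show ?thesis
    unfolding d_def e_def by (rule Lim_transform_eventually)
qed

text \<open>Passing from order \<open>n\<close> to \<open>n + 1\<close> multiplies every symbol by \<open>(1 + z) / 2\<close>, hence the
  transform by that of an interval of length \<open>2\<^sup>-\<^sup>m\<close>.\<close>

lemma refinable_transform_box_mean:
  assumes "n \<ge> 1" "m \<ge> 1" and g: "g \<in> Cc" and lim: "refinable_transform \<mu> n m g"
  shows "refinable_transform \<mu> (Suc n) m (box_mean (1 / 2 ^ m) g)"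
  unfolding refinable_transform_def
proof
  fix \<omega> :: real
  define h :: real where "h = 1 / 2 ^ m"
  define e where "e k = exp (- (\<i> * complex_of_real (\<omega> / 2 ^ k)))" for k :: nat
  have factor: "symbol_prod \<mu> (Suc n) m N \<omega> =
      (\<Prod>j<N. (1 + e (m + j + 1)) / 2) * symbol_prod \<mu> n m N \<omega>" for N
    using assms by (simp add: symbol_prod_def mask_symbol_Suc e_def prod.distrib[symmetric])
  have g_lim: "(\<lambda>N. symbol_prod \<mu> n m N \<omega>) \<longlonglongrightarrow> fourier g \<omega>"
    using lim by (simp add: refinable_transform_def)
  show "(\<lambda>N. symbol_prod \<mu> (Suc n) m N \<omega>) \<longlonglongrightarrow> fourier (box_mean (1 / 2 ^ m) g) \<omega>"
  proof (cases "\<omega> = 0")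
    case True
    then have "fourier (box_mean h g) \<omega> = fourier g \<omega>"
      using integral_box_mean[OF g, of h] by (simp add: fourier_def h_def)
    then show ?thesis
      unfolding factor using g_lim True by (simp add: e_def h_def)
  next
    case False
    have "(\<lambda>N. symbol_prod \<mu> (Suc n) m N \<omega>) \<longlonglongrightarrow>
        2 ^ m * (1 - e m) / (\<i> * of_real \<omega>) * fourier g \<omega>"
      unfolding factor
      using box_product_limit[OF False, of m] g_lim by (intro tendsto_mult) (simp_all add: e_def)
    also have "2 ^ m * (1 - e m) / (\<i> * of_real \<omega>) * fourier g \<omega> =
        fourier (nabla h g) \<omega> / (\<i> * of_real \<omega>)"
      using fourier_nabla[OF g, of h \<omega>] by (simp add: e_def h_def)
    also have "\<dots> = fourier (box_mean h g) \<omega>"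
      using False g fourier_derivative[OF box_mean_Cc[OF g] nabla_Cc[OF g]
          has_vector_derivative_box_mean[OF g], of h \<omega>]
      by (simp add: h_def)
    finally show ?thesis
      by (simp add: h_def)
  qed
qed

text \<open>At level \<open>0\<close> the symbol is \<open>(1 + z) / 2\<close> for every order.\<close>

lemma refinable_transform_level_0:
  assumes "g \<in> Cc" "refinable_transform \<mu> n 1 g"
  shows "refinable_transform \<mu> n 0 (\<lambda>x. (1/2) * (g x + g (x - 1/2)))"
  unfolding refinable_transform_def
proof
  fix \<omega> :: real
  define e where "e = exp (- (\<i> * complex_of_real (\<omega> / 2)))"
  have "(\<lambda>N. symbol_prod \<mu> n 0 (Suc N) \<omega>) \<longlonglongrightarrow> (1 + e) / 2 * fourier g \<omega>"
    using assms unfolding symbol_prod_shift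
    by (intro tendsto_mult) (auto simp: refinable_transform_def mask_symbol_0 e_def)
  also have "(1 + e) / 2 * fourier g \<omega> = fourier (\<lambda>x. (1/2) * (g x + g (x - 1/2))) \<omega>"
    using Cc_integrable[OF assms(1)]
    by (simp only: fourier_cmult fourier_add integrable_shift fourier_shift)
      (simp add: e_def field_simps)
  finally show "(\<lambda>N. symbol_prod \<mu> n 0 N \<omega>) \<longlonglongrightarrow> fourier (\<lambda>x. (1/2) * (g x + g (x - 1/2))) \<omega>"
    by (rule LIMSEQ_imp_Suc)
qed

section \<open>Refinement operators and lattice sums\<close>

definition refine :: "real \<Rightarrow> nat \<Rightarrow> nat \<Rightarrow> (real \<Rightarrow> complex) \<Rightarrow> real \<Rightarrow> complex" where
  "refine \<mu> n k g x =
     (\<Sum>\<alpha>\<le>n + 1. complex_of_real (mask \<mu> n k \<alpha>) * g (x - real \<alpha> / 2 ^ (k + 1)))"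

lemma refine_Cc: "g \<in> Cc \<Longrightarrow> refine \<mu> n k g \<in> Cc"
  unfolding refine_def[abs_def] by (intro Cc_sum Cc_cmult Cc_shift finite_atMost)

lemma fourier_refine:
  assumes "g \<in> Cc"
  shows "fourier (refine \<mu> n k g) \<omega> =
    mask_symbol \<mu> n k (exp (- (\<i> * complex_of_real (\<omega> / 2 ^ (k + 1))))) * fourier g \<omega>"
proof -
  have "fourier (refine \<mu> n k g) \<omega> =
      (\<Sum>\<alpha>\<le>n + 1. complex_of_real (mask \<mu> n k \<alpha>) *
        (exp (- (\<i> * complex_of_real (\<omega> * (real \<alpha> / 2 ^ (k + 1))))) * fourier g \<omega>))"
    unfolding refine_def[abs_def]
    by (subst fourier_sum)
      (auto simp: fourier_cmult fourier_shift intro!: Cc_integrable Cc_cmult Cc_shift assms)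
  also have "\<dots> = (\<Sum>\<alpha>\<le>n + 1. complex_of_real (mask \<mu> n k \<alpha>) *
        exp (- (\<i> * complex_of_real (\<omega> / 2 ^ (k + 1)))) ^ \<alpha> * fourier g \<omega>)"
    by (intro sum.cong refl) (simp add: exp_of_nat_mult[symmetric] mult_ac)
  finally show ?thesis
    by (simp only: mask_symbol_def sum_distrib_right)
qed

text \<open>A refinement step, which leads from the lattice of width \<open>2\<^bsup>-(k+1)\<^esup>\<close> to that of width \<open>2\<^sup>-\<^sup>k\<close>,
  halves such a bound apart from a factor that tends to \<open>1\<close> as \<open>k\<close> grows, whereas it need not decrease
  the supremum of \<open>g\<close>.  The halvings compensate for the height \<open>2\<^sup>N\<close> of the hat of level \<open>N\<close>.\<close>

definition lattice_bounded :: "real \<Rightarrow> real \<Rightarrow> (real \<Rightarrow> complex) \<Rightarrow> bool" where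
  "lattice_bounded h M g \<longleftrightarrow>
     (\<forall>x J. finite J \<longrightarrow> (\<Sum>j\<in>J. norm (g (x + real_of_int j * h))) \<le> M)"

lemma lattice_bounded_norm_le:
  assumes "lattice_bounded h M g"
  shows "norm (g x) \<le> M"
proof -
  have "(\<Sum>j\<in>{0}. norm (g (x + real_of_int j * h))) \<le> M"
    using assms unfolding lattice_bounded_def by blast
  then show ?thesis by simp
qed

text \<open>On the coarse lattice, the taps at \<open>0\<close> and \<open>2\<close> see only even multiples of \<open>h\<close> and the tap at \<open>1\<close>
  only odd ones.\<close>

lemma lattice_bounded_three_taps:
  assumes g: "lattice_bounded h M g"
    and A: "\<bar>a\<bar> + \<bar>c\<bar> \<le> A" "\<bar>b\<bar> \<le> A"
  shows "lattice_bounded (2 * h) (A * M)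
    (\<lambda>x. complex_of_real a * g x + of_real b * g (x - h) + of_real c * g (x - 2 * h))"
  unfolding lattice_bounded_def
proof (intro allI impI)
  fix x :: real and J :: "int set"
  assume J: "finite J"
  define v where "v i = norm (g (x + real_of_int i * h))" for i
  define E O' where "E = (\<lambda>j. 2 * j) ` J \<union> (\<lambda>j. 2 * j - 2) ` J" and "O' = (\<lambda>j. 2 * j - 1) ` J"
  have fin: "finite E" "finite O'"
    using J by (auto simp: E_def O'_def)
  have v: "v i \<ge> 0" for i
    by (simp add: v_def)
  have "A \<ge> 0"
    using A by linarith
  have tap: "(\<Sum>j\<in>J. v (2 * j - d)) \<le> sum v S" if "(\<lambda>j. 2 * j - d) ` J \<subseteq> S" "finite S" for d S
  proof -
    have "(\<Sum>j\<in>J. v (2 * j - d)) = sum v ((\<lambda>j. 2 * j - d) ` J)"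
      by (subst sum.reindex) (auto simp: inj_on_def)
    also have "\<dots> \<le> sum v S"
      using that v by (intro sum_mono2) auto
    finally show ?thesis .
  qed
  have 0: "(\<Sum>j\<in>J. v (2 * j)) \<le> sum v E"
    using tap[of 0 E] fin by (auto simp: E_def)
  have 1: "(\<Sum>j\<in>J. v (2 * j - 1)) \<le> sum v O'"
    using tap[of 1 O'] fin by (auto simp: O'_def)
  have 2: "(\<Sum>j\<in>J. v (2 * j - 2)) \<le> sum v E"
    using tap[of 2 E] fin by (auto simp: E_def)
  let ?T = "\<lambda>x. complex_of_real a * g x + of_real b * g (x - h) + of_real c * g (x - 2 * h)"
  have "norm (?T (x + real_of_int j * (2 * h))) \<le>
      \<bar>a\<bar> * v (2 * j) + \<bar>b\<bar> * v (2 * j - 1) + \<bar>c\<bar> * v (2 * j - 2)" for j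
  proof -
    have "x + real_of_int j * (2 * h) = x + real_of_int (2 * j) * h"
      "x + real_of_int j * (2 * h) - h = x + real_of_int (2 * j - 1) * h"
      "x + real_of_int j * (2 * h) - 2 * h = x + real_of_int (2 * j - 2) * h"
      by (simp_all add: algebra_simps)
    then show ?thesis
      unfolding v_def
      by (simp only:) (intro norm_triangle_le add_mono, simp_all add: norm_mult)
  qed
  then have "(\<Sum>j\<in>J. norm (?T (x + real_of_int j * (2 * h)))) \<le>
      \<bar>a\<bar> * (\<Sum>j\<in>J. v (2 * j)) + \<bar>b\<bar> * (\<Sum>j\<in>J. v (2 * j - 1)) + \<bar>c\<bar> * (\<Sum>j\<in>J. v (2 * j - 2))"
    unfolding sum_distrib_left sum.distrib[symmetric] by (intro sum_mono)
  also have "\<dots> \<le> \<bar>a\<bar> * sum v E + \<bar>b\<bar> * sum v O' + \<bar>c\<bar> * sum v E"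
    using 0 1 2 by (intro add_mono mult_left_mono) auto
  also have "\<dots> = (\<bar>a\<bar> + \<bar>c\<bar>) * sum v E + \<bar>b\<bar> * sum v O'"
    by (simp add: algebra_simps)
  also have "\<dots> \<le> A * sum v E + A * sum v O'"
    using A v by (intro add_mono mult_right_mono sum_nonneg) auto
  also have "\<dots> = A * sum v (E \<union> O')"
  proof -
    have "E \<inter> O' = {}"
      unfolding E_def O'_def by (auto; presburger)
    then show ?thesis
      using fin by (simp add: sum.union_disjoint distrib_left)
  qed
  also have "\<dots> \<le> A * M"
    using g fin \<open>A \<ge> 0\<close> unfolding lattice_bounded_def v_def by (intro mult_left_mono) auto
  finally show "(\<Sum>j\<in>J. norm (?T (x + real_of_int j * (2 * h)))) \<le> A * M" .
qed

lemma weight_nonneg: "weight \<mu> k \<ge> 0"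
  using ge_one_powr_ge_zero[of 2 "real k powr (- \<mu>)"] by simp

lemma refine_order_1:
  fixes \<mu> :: real
  assumes "k \<ge> 1"
  defines "w \<equiv> 2 powr (real k powr (- \<mu>))" and "h \<equiv> 1 / 2 ^ (k + 1)"
  shows "refine \<mu> 1 k g x = of_real (1 / (4 * w)) * g x + of_real (1 - 1 / (2 * w)) * g (x - h) +
    of_real (1 / (4 * w)) * g (x - 2 * h)"
proof -
  have w: "w > 0"
    by (simp add: w_def)
  have p: "2 powr (real 1 + 1 + real k powr (- \<mu>)) = 4 * w"
    by (simp add: powr_add w_def)
  have "mask \<mu> 1 k 0 = 1 / (4 * w)" "mask \<mu> 1 k 2 = 1 / (4 * w)" "mask \<mu> 1 k 1 = 1 - 1 / (2 * w)"
    using assms(1) w unfolding mask_def p by (simp_all add: w_def[symmetric] field_simps numeral_2_eq_2)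
  moreover have "{..1 + 1} = {0, 1, 2::nat}"
    by auto
  ultimately show ?thesis
    by (simp add: refine_def h_def)
qed

lemma lattice_bounded_refine:
  assumes "k \<ge> 1" "lattice_bounded (1 / 2 ^ Suc k) M g"
  shows "lattice_bounded (1 / 2 ^ k) (2 powr (real k powr (- \<mu>)) / 2 * M) (refine \<mu> 1 k g)"
proof -
  define w where "w = 2 powr (real k powr (- \<mu>))"
  have w: "w \<ge> 1"
    using weight_nonneg[where \<mu> = \<mu> and k = k] by (simp add: w_def)
  have "0 \<le> (w - 1)\<^sup>2"
    by simp
  then have "1 - 1 / (2 * w) \<le> w / 2" "1 / (2 * w) \<le> w / 2"
    using w by (simp_all add: field_simps power2_eq_square)
  then have "lattice_bounded (2 * (1 / 2 ^ Suc k)) (w / 2 * M) (\<lambda>x. of_real (1 / (4 * w)) * g x +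
      of_real (1 - 1 / (2 * w)) * g (x - 1 / 2 ^ Suc k) + of_real (1 / (4 * w)) * g (x - 2 * (1 / 2 ^ Suc k)))"
    using w by (intro lattice_bounded_three_taps assms) auto
  also have "(\<lambda>x. of_real (1 / (4 * w)) * g x +
      of_real (1 - 1 / (2 * w)) * g (x - 1 / 2 ^ Suc k) + of_real (1 / (4 * w)) * g (x - 2 * (1 / 2 ^ Suc k))) =
      refine \<mu> 1 k g"
    unfolding refine_order_1[OF assms(1)] w_def Suc_eq_plus1 fun_eq_iff by blast
  finally show ?thesis
    by (simp add: w_def)
qed

section \<open>Hat functions\<close>

definition hat :: "real \<Rightarrow> real" where
  "hat x = max 0 (1 - \<bar>x - 1\<bar>)"

definition scaled_hat :: "nat \<Rightarrow> real \<Rightarrow> complex" where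
  "scaled_hat N x = of_real (2 ^ N) * complex_of_real (hat (2 ^ N * x))"

lemma hat_Cc: "(\<lambda>x. complex_of_real (hat x)) \<in> Cc"
  by (rule CcI[where K = 2]) (auto simp: hat_def intro!: continuous_intros)

lemma scaled_hat_support: "x < 0 \<or> x > 2 / 2 ^ N \<Longrightarrow> scaled_hat N x = 0"
proof -
  assume "x < 0 \<or> x > 2 / 2 ^ N"
  then have "2 ^ N * x < 0 \<or> 2 ^ N * x > 2"
    by (simp add: mult_less_0_iff field_simps)
  then show ?thesis
    by (auto simp: scaled_hat_def hat_def)
qed

lemma scaled_hat_Cc: "scaled_hat N \<in> Cc"
proof (rule CcI[where K = 2])
  show "continuous_on UNIV (scaled_hat N)"
    unfolding scaled_hat_def[abs_def] hat_def by (intro continuous_intros)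
  fix x :: real
  assume "\<bar>x\<bar> > 2"
  moreover have "2 / 2 ^ N \<le> (2::real)"
    by (simp add: field_simps)
  ultimately show "scaled_hat N x = 0"
    by (intro scaled_hat_support) linarith
qed

lemma hat_two_scale: "hat x = hat (2 * x) / 2 + hat (2 * x - 1) + hat (2 * x - 2) / 2"
  by (auto simp: hat_def max_def abs_if field_simps)

lemma scaled_hat_two_scale:
  fixes N :: nat
  defines "h \<equiv> 1 / 2 ^ Suc N"
  shows "scaled_hat N x = of_real (1/4) * scaled_hat (Suc N) x +
    of_real (1/2) * scaled_hat (Suc N) (x - h) + of_real (1/4) * scaled_hat (Suc N) (x - 2 * h)"
proof -
  have "2 ^ Suc N * x = 2 * (2 ^ N * x)" "2 ^ Suc N * (x - h) = 2 * (2 ^ N * x) - 1"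
    "2 ^ Suc N * (x - 2 * h) = 2 * (2 ^ N * x) - 2"
    by (simp_all add: h_def field_simps)
  note args = this
  show ?thesis
    unfolding scaled_hat_def args hat_two_scale[of "2 ^ N * x"] by (simp add: algebra_simps)
qed

text \<open>At most two lattice points lie in the open interval where the hat is positive.\<close>

lemma lattice_bounded_scaled_hat: "lattice_bounded (1 / 2 ^ N) (2 * 2 ^ N) (scaled_hat N)"
  unfolding lattice_bounded_def
proof (intro allI impI)
  fix x :: real and J :: "int set"
  assume J: "finite J"
  define y where "y = 2 ^ N * x"
  define S where "S = {\<lfloor>- y\<rfloor> + 1, \<lfloor>- y\<rfloor> + 2}"
  have arg: "2 ^ N * (x + real_of_int j * (1 / 2 ^ N)) = y + real_of_int j" for j
    by (simp add: y_def field_simps)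
  have hat01: "0 \<le> hat t" "hat t \<le> 1" for t
    by (auto simp: hat_def)
  have outside: "hat (y + real_of_int j) = 0" if "j \<notin> S" for j
  proof -
    have "j \<le> \<lfloor>- y\<rfloor> \<or> j \<ge> \<lfloor>- y\<rfloor> + 3"
      using that by (auto simp: S_def)
    then have "y + real_of_int j \<le> 0 \<or> y + real_of_int j \<ge> 2"
      by linarith
    then show ?thesis
      by (auto simp: hat_def)
  qed
  have "(\<Sum>j\<in>J. norm (scaled_hat N (x + real_of_int j * (1 / 2 ^ N)))) =
      (\<Sum>j\<in>J. 2 ^ N * hat (y + real_of_int j))"
    unfolding scaled_hat_def arg using hat01 by (simp add: norm_mult norm_power)
  also have "\<dots> = (\<Sum>j\<in>J \<inter> S. 2 ^ N * hat (y + real_of_int j))"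
    using J outside by (intro sum.mono_neutral_right) auto
  also have "\<dots> \<le> of_nat (card (J \<inter> S)) * 2 ^ N"
    using hat01 by (intro sum_bounded_above) simp
  also have "\<dots> \<le> 2 * 2 ^ N"
  proof -
    have "card (J \<inter> S) \<le> card S"
      by (intro card_mono) (auto simp: S_def)
    also have "\<dots> = 2"
      by (simp add: S_def)
    finally show ?thesis
      by (intro mult_right_mono) auto
  qed
  finally show "(\<Sum>j\<in>J. norm (scaled_hat N (x + real_of_int j * (1 / 2 ^ N)))) \<le> 2 * 2 ^ N" .
qed

lemma integral_hat: "(LINT x|lborel. complex_of_real (hat x)) = 1"
proof -
  have "((\<lambda>x. x) has_integral (1\<^sup>2 / 2 - 0\<^sup>2 / 2)) {0..1::real}"
    by (rule fundamental_theorem_of_calculus)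
      (auto intro!: derivative_eq_intros simp flip: has_real_derivative_iff_has_vector_derivative)
  then have "((\<lambda>x. x) has_integral 1/2) {0..1::real}"
    by simp
  then have 1: "(hat has_integral 1/2) {0..1}"
    by (rule has_integral_eq[rotated]) (auto simp: hat_def)
  have "((\<lambda>x. 2 - x) has_integral ((2 * 2 - 2\<^sup>2 / 2) - (2 * 1 - 1\<^sup>2 / 2))) {1..2::real}"
    by (rule fundamental_theorem_of_calculus)
      (auto intro!: derivative_eq_intros simp flip: has_real_derivative_iff_has_vector_derivative)
  then have "((\<lambda>x. 2 - x) has_integral 1/2) {1..2::real}"
    by simp
  then have 2: "(hat has_integral 1/2) {1..2}"
    by (rule has_integral_eq[rotated]) (auto simp: hat_def)
  have "(hat has_integral 1) {0..2}"
    using has_integral_combine[OF _ _ 1 2] by simp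
  then have "(hat has_integral 1) UNIV"
    by (rule has_integral_on_superset[where S = "{0..2}"]) (auto simp: hat_def)
  moreover have "integrable lborel hat"
    using integrable_Re[OF Cc_integrable[OF hat_Cc]] by simp
  ultimately have "(LINT x|lborel. hat x) = 1"
    using has_integral_integral_lborel[of hat] has_integral_unique by blast
  then show ?thesis
    by simp
qed

lemma fourier_scaled_hat_tendsto: "(\<lambda>i. fourier (scaled_hat (m + i)) \<omega>) \<longlonglongrightarrow> 1"
proof -
  have "(\<lambda>N. \<omega> / 2 ^ N) \<longlonglongrightarrow> 0"
    using tendsto_mult_right_zero[OF LIMSEQ_power_zero[of "1/2 :: real"], of \<omega>]
    by (simp add: power_divide)
  then have "(\<lambda>N. fourier (\<lambda>x. complex_of_real (hat x)) (\<omega> / 2 ^ N)) \<longlonglongrightarrow> 1"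
    using fourier_tendsto_0[OF Cc_integrable[OF hat_Cc]] by (simp only: integral_hat)
  moreover have "fourier (scaled_hat N) \<omega> = fourier (\<lambda>x. complex_of_real (hat x)) (\<omega> / 2 ^ N)" for N
    unfolding scaled_hat_def[abs_def] by (rule fourier_dilate) simp
  ultimately show ?thesis
    using LIMSEQ_ignore_initial_segment[where k = m] by (simp add: add.commute)
qed

text \<open>For vanishing weight the mask of order \<open>1\<close> is the mask of the hat, so one refinement step moves a
  scaled hat by an amount proportional to the weight.\<close>

lemma lattice_bounded_refine_hat_diff:
  assumes "k \<ge> 1"
  shows "lattice_bounded (1 / 2 ^ k) (weight \<mu> k * (2 * 2 ^ k))
    (\<lambda>x. refine \<mu> 1 k (scaled_hat (Suc k)) x - scaled_hat k x)"
proof -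
  define w where "w = 2 powr (real k powr (- \<mu>))"
  define h :: real where "h = 1 / 2 ^ Suc k"
  have w: "w \<ge> 1"
    using weight_nonneg[where \<mu> = \<mu> and k = k] by (simp add: w_def)
  have "0 \<le> (w - 1)\<^sup>2"
    by simp
  then have b: "1/2 - 1 / (2 * w) \<le> (w - 1) / 2"
    using w by (simp add: field_simps power2_eq_square)
  have abs: "\<bar>1 / (4 * w) - 1/4\<bar> = 1/4 - 1 / (4 * w)" "\<bar>(1 - 1 / (2 * w)) - 1/2\<bar> = 1/2 - 1 / (2 * w)"
    using w by (simp_all add: field_simps)
  have half: "1/4 - 1 / (4 * w) + (1/4 - 1 / (4 * w)) = 1/2 - 1 / (2 * w)"
    by simp
  have "lattice_bounded (2 * h) ((w - 1) / 2 * (2 * 2 ^ Suc k))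
      (\<lambda>x. complex_of_real (1 / (4 * w) - 1/4) * scaled_hat (Suc k) x +
        of_real ((1 - 1 / (2 * w)) - 1/2) * scaled_hat (Suc k) (x - h) +
        of_real (1 / (4 * w) - 1/4) * scaled_hat (Suc k) (x - 2 * h))"
    unfolding h_def
    using b by (intro lattice_bounded_three_taps lattice_bounded_scaled_hat) (simp_all only: abs half)
  also have "(\<lambda>x. complex_of_real (1 / (4 * w) - 1/4) * scaled_hat (Suc k) x +
        of_real ((1 - 1 / (2 * w)) - 1/2) * scaled_hat (Suc k) (x - h) +
        of_real (1 / (4 * w) - 1/4) * scaled_hat (Suc k) (x - 2 * h)) =
      (\<lambda>x. refine \<mu> 1 k (scaled_hat (Suc k)) x - scaled_hat k x)"
    unfolding refine_order_1[OF assms, of \<mu> "scaled_hat (Suc k)"] scaled_hat_two_scale[of k]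
      w_def[symmetric] Suc_eq_plus1[symmetric] h_def[symmetric] fun_eq_iff of_real_diff
    by (simp only: algebra_simps) simp
  finally show ?thesis
    by (simp add: w_def h_def mult_ac)
qed

section \<open>The refinable functions of order one are continuous\<close>

primrec cascade :: "real \<Rightarrow> nat \<Rightarrow> nat \<Rightarrow> (real \<Rightarrow> complex) \<Rightarrow> real \<Rightarrow> complex" where
  "cascade \<mu> m 0 g = g"
| "cascade \<mu> m (Suc i) g = refine \<mu> 1 m (cascade \<mu> (Suc m) i g)"

lemma cascade_Suc_inner: "cascade \<mu> m (Suc i) g = cascade \<mu> m i (refine \<mu> 1 (m + i) g)"
  by (induction i arbitrary: m) simp_all

lemma cascade_Cc: "g \<in> Cc \<Longrightarrow> cascade \<mu> m i g \<in> Cc"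
  by (induction i arbitrary: m) (auto intro: refine_Cc)

lemma refine_diff: "refine \<mu> n k (\<lambda>x. f x - g x) = (\<lambda>x. refine \<mu> n k f x - refine \<mu> n k g x)"
  by (simp add: fun_eq_iff refine_def right_diff_distrib sum_subtractf)

lemma cascade_diff: "cascade \<mu> m i (\<lambda>x. f x - g x) = (\<lambda>x. cascade \<mu> m i f x - cascade \<mu> m i g x)"
  by (induction i arbitrary: m) (simp_all only: cascade.simps refine_diff)

lemma fourier_cascade:
  "g \<in> Cc \<Longrightarrow> fourier (cascade \<mu> m i g) \<omega> = symbol_prod \<mu> 1 m i \<omega> * fourier g \<omega>"
proof (induction i arbitrary: m)
  case 0
  show ?case by (simp add: symbol_prod_def)
next
  case (Suc i)
  then show ?case
    unfolding cascade.simps symbol_prod_shift by (subst fourier_refine) (auto intro: cascade_Cc)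
qed

lemma cascade_support:
  assumes "\<And>x. x < 0 \<or> x > 2 / 2 ^ (m + i) \<Longrightarrow> g x = 0" and "x < 0 \<or> x > 2 / 2 ^ m"
  shows "cascade \<mu> m i g x = 0"
  using assms
proof (induction i arbitrary: m x)
  case (Suc i)
  have "cascade \<mu> (Suc m) i g (x - real \<alpha> / 2 ^ (m + 1)) = 0" if "\<alpha> \<le> 1 + 1" for \<alpha>
  proof (rule Suc.IH)
    show "g y = 0" if "y < 0 \<or> y > 2 / 2 ^ (Suc m + i)" for y
      using Suc.prems(1) that by simp
    have "real \<alpha> / 2 ^ (m + 1) \<le> 2 / 2 ^ (m + 1)"
      using that by (intro divide_right_mono) auto
    moreover have "0 \<le> real \<alpha> / 2 ^ (m + 1)"
      by simp
    moreover have "2 / 2 ^ m = 2 / 2 ^ (m + 1) + 2 / (2 ^ (m + 1) :: real)" "2 / 2 ^ Suc m = (2 / 2 ^ (m + 1) :: real)"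
      by simp_all
    ultimately show "x - real \<alpha> / 2 ^ (m + 1) < 0 \<or> x - real \<alpha> / 2 ^ (m + 1) > 2 / 2 ^ Suc m"
      using Suc.prems(2) by linarith
  qed
  then show ?case
    by (simp add: refine_def)
qed simp

lemma lattice_bounded_cascade:
  assumes "m \<ge> 1" "lattice_bounded (1 / 2 ^ (m + i)) M g"
  shows "lattice_bounded (1 / 2 ^ m) ((\<Prod>j<i. 2 powr (real (m + j) powr (- \<mu>)) / 2) * M)
    (cascade \<mu> m i g)"
  using assms
proof (induction i arbitrary: m)
  case (Suc i)
  have "lattice_bounded (1 / 2 ^ Suc m)
      ((\<Prod>j<i. 2 powr (real (Suc m + j) powr (- \<mu>)) / 2) * M) (cascade \<mu> (Suc m) i g)"
    using Suc.prems by (intro Suc.IH) auto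
  from lattice_bounded_refine[OF Suc.prems(1) this, of \<mu>] show ?case
    by (subst prod.lessThan_Suc_shift) (simp add: mult.assoc)
qed simp

text \<open>Here \<open>\<mu> > 1\<close> enters: the product of the factors \<open>2 powr k\<^sup>-\<^sup>\<mu>\<close> and the sum of the weights
  converge because \<open>\<Sum> k\<^sup>-\<^sup>\<mu>\<close> does.\<close>

lemma summable_exponents: "\<mu> > 1 \<Longrightarrow> summable (\<lambda>k. real k powr (- \<mu>))"
  using summable_real_powr_iff[of "- \<mu>"] by simp

lemma factors_bounded:
  assumes "\<mu> > 1"
  shows "(\<Prod>j<i. 2 powr (real (m + j) powr (- \<mu>)) / 2) \<le> 2 powr (\<Sum>k. real k powr (- \<mu>)) / 2 ^ i"
proof -
  have "(\<Prod>j<i. 2 powr (real (m + j) powr (- \<mu>)) / 2) =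
      2 powr (\<Sum>j<i. real (m + j) powr (- \<mu>)) / 2 ^ i"
    by (simp add: powr_sum prod_dividef)
  also have "(\<Sum>j<i. real (m + j) powr (- \<mu>)) = (\<Sum>k\<in>(+) m ` {..<i}. real k powr (- \<mu>))"
    by (subst sum.reindex) auto
  also have "2 powr \<dots> / 2 ^ i \<le> 2 powr (\<Sum>k. real k powr (- \<mu>)) / 2 ^ i"
    by (intro divide_right_mono powr_mono sum_le_suminf summable_exponents assms) auto
  finally show ?thesis .
qed

lemma summable_weight:
  assumes "\<mu> > 1"
  shows "summable (\<lambda>k. weight \<mu> k)"
proof (rule summable_comparison_test')
  show "summable (\<lambda>k. 2 * real k powr (- \<mu>))"
    by (intro summable_mult summable_exponents assms)
  fix k :: nat
  assume "k \<ge> 1"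
  define s where "s = real k powr (- \<mu>)"
  have s: "0 \<le> s" "s \<le> 1"
    using assms \<open>k \<ge> 1\<close> powr_mono[of "- \<mu>" 0 "real k"] by (auto simp: s_def)
  have ln: "0 < ln (2::real)" "ln 2 \<le> (1::real)"
    using ln_2_less_1 by auto
  have "s * ln 2 \<le> 1 * 1"
    using s ln by (intro mult_mono) auto
  then have "exp (s * ln 2) \<le> 1 + s * ln 2 + (s * ln 2)\<^sup>2"
    using s ln by (intro exp_bound) auto
  moreover have "s * ln 2 \<le> s * 1"
    using s ln by (intro mult_left_mono) auto
  moreover have "(s * ln 2)\<^sup>2 \<le> s * ln 2"
    unfolding power2_eq_square using s ln \<open>s * ln 2 \<le> 1 * 1\<close> by (intro mult_left_le) auto
  ultimately have "2 powr s - 1 \<le> 2 * s"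
    by (simp add: powr_def)
  then show "norm (weight \<mu> k) \<le> 2 * real k powr (- \<mu>)"
    using weight_nonneg[where \<mu> = \<mu> and k = k] by (simp add: s_def)
qed

text \<open>The cascade started from finer and finer hats converges uniformly.  All iterates vanish
  outside the interval from \<open>0\<close> to \<open>2 / 2\<^sup>m\<close>, so the transforms converge as well; those of the starting
  hats tend to \<open>1\<close>, which leaves the product of the symbols.\<close>

lemma refinable_order_1_exists:
  assumes "\<mu> > 1" "m \<ge> 1"
  shows "\<exists>g \<in> Cc. refinable_transform \<mu> 1 m g"
proof -
  define B where "B = 2 powr (\<Sum>k. real k powr (- \<mu>))"
  define f where "f i = cascade \<mu> m i (scaled_hat (m + i))" for i
  define d where "d i x = f (Suc i) x - f i x" for i x
  have f_Cc: "f i \<in> Cc" for i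
    unfolding f_def by (intro cascade_Cc scaled_hat_Cc)
  have f_support: "f i x = 0" if "x < 0 \<or> x > 2 / 2 ^ m" for i x
    unfolding f_def using scaled_hat_support that by (rule cascade_support)
  have bound: "norm (cascade \<mu> m i g x) \<le> B / 2 ^ i * M"
    if g: "lattice_bounded (1 / 2 ^ (m + i)) M g" for i g M x
  proof -
    have "M \<ge> 0"
      using lattice_bounded_norm_le[OF g, of 0] norm_ge_zero order_trans by blast
    have "norm (cascade \<mu> m i g x) \<le> (\<Prod>j<i. 2 powr (real (m + j) powr (- \<mu>)) / 2) * M"
      by (rule lattice_bounded_norm_le[OF lattice_bounded_cascade[OF assms(2) g]])
    also have "\<dots> \<le> B / 2 ^ i * M"
      unfolding B_def using \<open>M \<ge> 0\<close> by (intro mult_right_mono factors_bounded assms)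
    finally show ?thesis .
  qed
  have f_bound: "norm (f i x) \<le> B * (2 * 2 ^ m)" for i x
    using bound[OF lattice_bounded_scaled_hat, of i x] by (simp add: f_def power_add)
  have d_eq: "d i x =
      cascade \<mu> m i (\<lambda>x. refine \<mu> 1 (m + i) (scaled_hat (Suc (m + i))) x - scaled_hat (m + i) x) x"
    for i x
    unfolding d_def f_def cascade_Suc_inner cascade_diff by simp
  have d_bound: "norm (d i x) \<le> B * (2 * 2 ^ m) * weight \<mu> (i + m)" for i x
  proof -
    have "norm (d i x) \<le> B / 2 ^ i * (weight \<mu> (m + i) * (2 * 2 ^ (m + i)))"
      unfolding d_eq using assms(2) by (intro bound lattice_bounded_refine_hat_diff) simp
    then show ?thesis
      by (simp add: power_add mult_ac add.commute)
  qed
  define g where "g x = f 0 x + (\<Sum>i. d i x)" for x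
  have f_sum: "f i x = f 0 x + (\<Sum>j<i. d j x)" for i x
    unfolding d_def using sum_lessThan_telescope[of "\<lambda>i. f i x" i] by simp
  have unif: "uniform_limit UNIV f g sequentially"
  proof -
    have "uniform_limit UNIV (\<lambda>i x. \<Sum>j<i. d j x) (\<lambda>x. \<Sum>i. d i x) sequentially"
      using d_bound
      by (intro Weierstrass_m_test[where M = "\<lambda>i. B * (2 * 2 ^ m) * weight \<mu> (i + m)"]
          summable_mult summable_ignore_initial_segment summable_weight assms) auto
    then have "uniform_limit UNIV (\<lambda>i x. f 0 x + (\<Sum>j<i. d j x)) g sequentially"
      unfolding g_def[abs_def] by (intro uniform_limit_add uniform_limit_const)
    then show ?thesis
      by (simp only: f_sum[symmetric])
  qed
  have lim: "(\<lambda>i. f i x) \<longlonglongrightarrow> g x" for x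
    using unif by (rule tendsto_uniform_limitI) simp
  have g_Cc: "g \<in> Cc"
  proof (rule CcI[where K = 2])
    show "continuous_on UNIV g"
      using unif Cc_continuous[OF f_Cc] by (intro uniform_limit_theorem) auto
    fix x :: real
    assume "\<bar>x\<bar> > 2"
    moreover have "2 / 2 ^ m \<le> (2::real)"
      by (simp add: field_simps)
    ultimately have "f i x = 0" for i
      by (intro f_support) linarith
    then show "g x = 0"
      using lim[of x] by (simp add: LIMSEQ_const_iff)
  qed
  have "refinable_transform \<mu> 1 m g"
    unfolding refinable_transform_def
  proof
    fix \<omega> :: real
    have "(\<lambda>i. fourier (f i) \<omega>) \<longlonglongrightarrow> fourier g \<omega>"
      unfolding fourier_def
    proof (rule integral_dominated_convergence)
      show "integrable lborel (\<lambda>x::real. indicator {0..2 / 2 ^ m} x *\<^sub>R (B * (2 * 2 ^ m)))"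
        by (intro borel_integrable_compact) auto
      show "AE x in lborel. (\<lambda>i. f i x * exp (- (\<i> * complex_of_real (\<omega> * x))))
          \<longlonglongrightarrow> g x * exp (- (\<i> * complex_of_real (\<omega> * x)))"
        by (intro AE_I2 tendsto_intros lim)
      show "AE x in lborel. norm (f i x * exp (- (\<i> * complex_of_real (\<omega> * x)))) \<le>
          indicator {0..2 / 2 ^ m} x *\<^sub>R (B * (2 * 2 ^ m))" for i
        unfolding norm_mult norm_fourier_kernel
        using f_bound[of i] f_support[of _ i] by (intro AE_I2) (auto simp: indicator_def not_le)
    qed (intro borel_measurable_integrable fourier_integrand_integrable Cc_integrable f_Cc g_Cc)+
    then have "(\<lambda>i. symbol_prod \<mu> 1 m i \<omega> * fourier (scaled_hat (m + i)) \<omega>) \<longlonglongrightarrow> fourier g \<omega>"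
      unfolding f_def by (simp add: fourier_cascade scaled_hat_Cc)
    from tendsto_divide[OF this fourier_scaled_hat_tendsto[of m \<omega>]]
    have "(\<lambda>i. symbol_prod \<mu> 1 m i \<omega> * fourier (scaled_hat (m + i)) \<omega> / fourier (scaled_hat (m + i)) \<omega>)
        \<longlonglongrightarrow> fourier g \<omega>"
      by (simp only: div_by_1 one_neq_zero not_False_eq_True)
    moreover have "eventually (\<lambda>i. symbol_prod \<mu> 1 m i \<omega> * fourier (scaled_hat (m + i)) \<omega> /
        fourier (scaled_hat (m + i)) \<omega> = symbol_prod \<mu> 1 m i \<omega>) sequentially"
      using tendsto_imp_eventually_ne[OF fourier_scaled_hat_tendsto[of m \<omega>], of 0]
      by (auto elim: eventually_mono)
    ultimately show "(\<lambda>N. symbol_prod \<mu> 1 m N \<omega>) \<longlonglongrightarrow> fourier g \<omega>"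
      by (rule Lim_transform_eventually)
  qed
  with g_Cc show ?thesis
    by blast
qed

section \<open>Derivatives of the refinable functions\<close>

lemma borel_measurable_nabla:
  assumes [measurable]: "f \<in> borel_measurable borel"
  shows "nabla h f \<in> borel_measurable borel"
  unfolding nabla_def by measurable

lemma borel_measurable_nabla_pow:
  "f \<in> borel_measurable borel \<Longrightarrow> (nabla h ^^ j) f \<in> borel_measurable borel"
  by (induction j) (simp_all add: borel_measurable_nabla)

lemma AE_nabla_pow_cong:
  assumes "f \<in> borel_measurable borel" "g \<in> borel_measurable borel" and eq: "AE x in lborel. f x = g x"
  shows "AE x in lborel. (nabla h ^^ j) f x = (nabla h ^^ j) g x"
proof (induction j)
  case (Suc j)
  have [measurable]: "(nabla h ^^ j) f \<in> borel_measurable borel" "(nabla h ^^ j) g \<in> borel_measurable borel"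
    using assms by (simp_all add: borel_measurable_nabla_pow)
  have "AE x in lborel. (nabla h ^^ j) f (- h + 1 * x) = (nabla h ^^ j) g (- h + 1 * x)"
    using Suc by (intro AE_borel_affine) auto
  with Suc show ?case
    by eventually_elim (simp add: nabla_def[of h "(nabla h ^^ j) f"] nabla_def[of h "(nabla h ^^ j) g"])
qed (use eq in simp)

text \<open>For \<open>m \<ge> 1\<close> the continuous representatives of all orders are obtained from the one of order \<open>1\<close>
  by repeated averaging; \<open>\<gamma> i\<close> has order \<open>i + 1\<close>.\<close>

lemma representatives_positive_level:
  assumes "\<mu> > 1" "m \<ge> 1"
  obtains \<gamma> where "\<And>i. \<gamma> i \<in> Cc" "\<And>i. refinable_transform \<mu> (Suc i) m (\<gamma> i)"
    "\<And>i x. (\<gamma> (Suc i) has_vector_derivative nabla (1 / 2 ^ m) (\<gamma> i) x) (at x)"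
proof -
  obtain g where g: "g \<in> Cc" "refinable_transform \<mu> 1 m g"
    using refinable_order_1_exists[OF assms] by blast
  define \<gamma> where "\<gamma> i = (box_mean (1 / 2 ^ m) ^^ i) g" for i
  have Cc: "\<gamma> i \<in> Cc" for i
    unfolding \<gamma>_def by (induction i) (auto intro: g box_mean_Cc)
  have "refinable_transform \<mu> (Suc i) m (\<gamma> i)" for i
  proof (induction i)
    case (Suc i)
    then show ?case
      using refinable_transform_box_mean[OF _ assms(2) Cc, of "Suc i" \<mu> i] by (simp add: \<gamma>_def)
  qed (use g in \<open>simp add: \<gamma>_def\<close>)
  moreover have "(\<gamma> (Suc i) has_vector_derivative nabla (1 / 2 ^ m) (\<gamma> i) x) (at x)" for i x
    using has_vector_derivative_box_mean[OF Cc, of "1 / 2 ^ m" i x] by (simp add: \<gamma>_def)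
  ultimately show ?thesis
    using that Cc by blast
qed

lemma representatives_level_0:
  assumes "\<mu> > 1"
  obtains \<gamma> where "\<And>i. \<gamma> i \<in> Cc" "\<And>i. refinable_transform \<mu> (Suc i) 0 (\<gamma> i)"
    "\<And>i x. (\<gamma> (Suc i) has_vector_derivative nabla (1 / 2) (\<gamma> i) x) (at x)"
proof -
  obtain \<gamma> where \<gamma>: "\<And>i. \<gamma> i \<in> Cc" "\<And>i. refinable_transform \<mu> (Suc i) 1 (\<gamma> i)"
    "\<And>i x. (\<gamma> (Suc i) has_vector_derivative nabla (1 / 2 ^ 1) (\<gamma> i) x) (at x)"
    using representatives_positive_level[OF assms, of 1] by auto
  show ?thesis
  proof (rule that[of "\<lambda>i x. (1/2) * (\<gamma> i x + \<gamma> i (x - 1/2))"])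
    show "(\<lambda>x. (1/2) * (\<gamma> i x + \<gamma> i (x - 1/2))) \<in> Cc" for i
      by (intro Cc_cmult Cc_add Cc_shift \<gamma>)
    show "refinable_transform \<mu> (Suc i) 0 (\<lambda>x. (1/2) * (\<gamma> i x + \<gamma> i (x - 1/2)))" for i
      by (intro refinable_transform_level_0 \<gamma>)
    fix i x
    have "((\<lambda>x. (1/2) * (\<gamma> (Suc i) x + \<gamma> (Suc i) (x - 1/2))) has_vector_derivative
        (1/2) * (nabla (1 / 2 ^ 1) (\<gamma> i) x + nabla (1 / 2 ^ 1) (\<gamma> i) (x - 1/2))) (at x)"
      by (intro has_vector_derivative_mult_right has_vector_derivative_add \<gamma>
          has_vector_derivative_shift)
    then show "((\<lambda>x. (1/2) * (\<gamma> (Suc i) x + \<gamma> (Suc i) (x - 1/2))) has_vector_derivative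
        nabla (1/2) (\<lambda>x. (1/2) * (\<gamma> i x + \<gamma> i (x - 1/2))) x) (at x)"
      by (simp add: nabla_def algebra_simps)
  qed
qed

lemma has_L2_deriv_of_representatives:
  assumes "r < n" and \<phi>: "\<And>n. n \<ge> 1 \<Longrightarrow> is_refinable \<mu> n m (\<phi> n)"
    and \<gamma>: "\<And>i. \<gamma> i \<in> Cc" "\<And>i. refinable_transform \<mu> (Suc i) m (\<gamma> i)"
      "\<And>i x. (\<gamma> (Suc i) has_vector_derivative nabla h (\<gamma> i) x) (at x)"
  shows "has_L2_deriv r (\<phi> n) ((nabla h ^^ r) (\<phi> (n - r)))"
proof -
  \<comment> \<open>The sequence \<open>\<gamma>\<close> starts at order \<open>1\<close>, so order \<open>n - r\<close> has the index \<open>n - r - 1\<close>.\<close>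
  define i where "i = n - r - 1"
  have orders: "n = Suc (i + r)" "n - r = Suc i"
    using assms(1) by (auto simp: i_def)
  have AE: "AE x in lborel. \<gamma> j x = \<phi> (Suc j) x" for j
    using is_refinable_imp_AE_eq[OF \<phi> \<gamma>(2) \<gamma>(1), of j] by (auto elim: eventually_mono)
  have "\<gamma> i \<in> borel_measurable borel"
    using Cc_continuous[OF \<gamma>(1)] by (rule borel_measurable_continuous_onI)
  moreover have "\<phi> (Suc i) \<in> borel_measurable borel"
    using \<phi>[of "Suc i"] by (simp add: is_refinable_def L2_def)
  ultimately have "AE x in lborel. (nabla h ^^ r) (\<gamma> i) x = (nabla h ^^ r) (\<phi> (Suc i)) x"
    using AE by (rule AE_nabla_pow_cong)
  then show ?thesis
    unfolding has_L2_deriv_def orders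
    using backward_difference_chain(1)[of \<gamma> h, OF \<gamma>(1,3), of r i]
      backward_difference_chain(2)[of \<gamma> h, OF \<gamma>(1,3), of i r] AE[of "i + r"]
    by (intro bexI[of _ "\<gamma> (i + r)"]) simp_all
qed

theorem theorem4p5:
  fixes \<mu> :: real and n r :: nat and \<phi> :: "nat \<Rightarrow> nat \<Rightarrow> real \<Rightarrow> complex"
  assumes "\<mu> > 1" and "n \<ge> 2" and "r \<le> n - 1"
    and "\<And>n m. n \<ge> 1 \<Longrightarrow> is_refinable \<mu> n m (\<phi> n m)"
  shows "has_L2_deriv r (\<phi> n 0) ((nabla (1 / 2) ^^ r) (\<phi> (n - r) 0)) \<and>
         (\<forall>m>0. has_L2_deriv r (\<phi> n m) ((nabla (1 / 2 ^ m) ^^ r) (\<phi> (n - r) m)))"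
proof (intro conjI allI impI)
  have r: "r < n"
    using assms by linarith
  obtain \<gamma> where \<gamma>: "\<And>i. \<gamma> i \<in> Cc" "\<And>i. refinable_transform \<mu> (Suc i) 0 (\<gamma> i)"
    "\<And>i x. (\<gamma> (Suc i) has_vector_derivative nabla (1 / 2) (\<gamma> i) x) (at x)"
    using representatives_level_0[OF assms(1)] by blast
  show "has_L2_deriv r (\<phi> n 0) ((nabla (1 / 2) ^^ r) (\<phi> (n - r) 0))"
    using r assms(4) \<gamma> by (rule has_L2_deriv_of_representatives)
  fix m :: nat
  assume "m > 0"
  then obtain \<gamma> where \<gamma>: "\<And>i. \<gamma> i \<in> Cc" "\<And>i. refinable_transform \<mu> (Suc i) m (\<gamma> i)"
    "\<And>i x. (\<gamma> (Suc i) has_vector_derivative nabla (1 / 2 ^ m) (\<gamma> i) x) (at x)"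
    using representatives_positive_level[OF assms(1), of m] by auto
  show "has_L2_deriv r (\<phi> n m) ((nabla (1 / 2 ^ m) ^^ r) (\<phi> (n - r) m))"
    using r assms(4) \<gamma> by (rule has_L2_deriv_of_representatives)
qed

end
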